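(* Let $d\ge 2$ and $N>1$ be integers, and let $S_{\mathbf a,\mathbf b}\subset\mathbb R^d$ be the two-row Hermite normal form simplex associated with $\mathbf a=(1,\ldots,1,N)\in\mathbb Z^d$ and $\mathbf b=(M-1,\ldots,M-1,M,0)\in\mathbb Z^d$. If $M=d-1$ or $M=d$, then $S_{\mathbf a,\mathbf b}$ admits a regular and unimodular triangulation. When $d=3$ and $M=d-1$, the triangulation can additionally be chosen flag.
   Context: For $\mathbf b=(b_1,\ldots,b_{d-2},M,0)$ and $\mathbf a=(a_1,\ldots,a_{d-1},N)$ in $\mathbb Z^d$, the two-row Hermite normal form simplex $S_{\mathbf a,\mathbf b}$ is the convex hull in $\mathbb R^d$ of $\mathbf v_0=\mathbf 0$, $\mathbf v_i=\mathbf e_i$ (standard unit vectors) for $1\le i\le d-2$, $\mathbf v_{d-1}=\mathbf b$, and $\mathbf v_d=\mathbf a$. In $\mathbf b=(M-1,\ldots,M-1,M,0)$ the first $d-2$ entries equal $M-1$; in $\mathbf a=(1,\ldots,1,N)$ the first $d-1$ entries equal $1$. A (lattice) triangulation of a $d$-dimensional lattice polytope $P\subset\mathbb R^d$ is a collection $\mathcal T$ of $d$-dimensional lattice simplices (vertices in $\mathbb Z^d$) whose union is $P$ and such that any two intersect in a common face. Let $\mathrm{Vert}(\mathcal T)$ be the set of all vertices of simplices in $\mathcal T$. $\mathcal T$ is regular if there is $\omega:\mathrm{Vert}(\mathcal T)\to\mathbb R$ such that $\mathcal T$ is the projection of the lower faces of $\mathrm{conv}\{(\mathbf v,\omega(\mathbf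 v)):\mathbf v\in\mathrm{Vert}(\mathcal T)\}\subset\mathbb R^{d+1}$. $\mathcal T$ is flag if all minimal non-faces (of the simplicial complex on $\mathrm{Vert}(\mathcal T)$ generated by $\mathcal T$) have size $2$. $\mathcal T$ is unimodular if every simplex in it has normalized volume ($d!$ times Euclidean volume) equal to $1$. *)

theory Defs
  imports "HOL-Analysis.Analysis"
begin

text \<open>
  Points of \<open>\<real>\<^sup>d\<close> are elements of \<^typ>\<open>real ^ 'n\<close> with \<open>d = CARD('n)\<close>. Since the index type \<open>'n\<close>
  carries no order, a bijection \<open>e\<close> from \<open>{1..d}\<close> onto it names the coordinates: the \<open>i\<close>-th
  coordinate of \<open>x\<close> is \<open>x $ e i\<close>.
\<close>

definition real_vec :: "int ^ 'n \<Rightarrow> real ^ 'n" where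
  "real_vec v = (\<chi> k. of_int (v $ k))"

definition hnf_simplex :: "(nat \<Rightarrow> 'n) \<Rightarrow> int ^ 'n \<Rightarrow> int ^ 'n \<Rightarrow> (real ^ 'n::finite) set" where
  "hnf_simplex e a b =
     convex hull ({0} \<union> (\<lambda>i. axis (e i) 1) ` {1..CARD('n) - 2} \<union> {real_vec b, real_vec a})"

definition vertices :: "(real ^ 'n) set \<Rightarrow> (real ^ 'n) set" where
  "vertices S = {v. v extreme_point_of S}"

definition lattice_triangulation :: "(real ^ 'n::finite) set \<Rightarrow> (real ^ 'n) set set \<Rightarrow> bool" where
  "lattice_triangulation P \<T> \<longleftrightarrow>
     triangulation \<T> \<and>
     (\<forall>S\<in>\<T>. int CARD('n) simplex S \<and> vertices S \<subseteq> range real_vec) \<and>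
     \<Union>\<T> = P"

definition Vert :: "(real ^ 'n) set set \<Rightarrow> (real ^ 'n) set" where
  "Vert \<T> = (\<Union>S\<in>\<T>. vertices S)"

text \<open>
  Lower faces are those cut out by a supporting hyperplane whose outer normal has negative last
  coordinate; compare \<open>exposed_face_of\<close>.
\<close>

definition lower_face_of ::
    "((real ^ 'n::finite) \<times> real) set \<Rightarrow> ((real ^ 'n) \<times> real) set \<Rightarrow> bool"
    (infixr \<open>lower'_face'_of\<close> 50) where
  "F lower_face_of Q \<longleftrightarrow>
     F face_of Q \<and> (\<exists>u \<beta>. snd u < 0 \<and> Q \<subseteq> {z. u \<bullet> z \<le> \<beta>} \<and> F = Q \<inter> {z. u \<bullet> z = \<beta>})"

text \<open>
  As \<open>\<T>\<close> lists only its \<open>d\<close>-dimensional simplices, it is compared with the projections of the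
  \<open>d\<close>-dimensional lower faces. Only the values of \<open>\<omega>\<close> on \<open>Vert \<T>\<close> matter.
\<close>

definition regular_triangulation :: "(real ^ 'n::finite) set set \<Rightarrow> bool" where
  "regular_triangulation \<T> \<longleftrightarrow>
     (\<exists>\<omega> :: real ^ 'n \<Rightarrow> real.
        \<T> = {fst ` F | F. F lower_face_of (convex hull ((\<lambda>v. (v, \<omega> v)) ` Vert \<T>)) \<and>
                        aff_dim F = int CARD('n)})"

definition is_face :: "(real ^ 'n) set set \<Rightarrow> (real ^ 'n) set \<Rightarrow> bool" where
  "is_face \<T> \<sigma> \<longleftrightarrow> (\<exists>S\<in>\<T>. \<sigma> \<subseteq> vertices S)"

definition minimal_nonface :: "(real ^ 'n) set set \<Rightarrow> (real ^ 'n) set \<Rightarrow> bool" where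
  "minimal_nonface \<T> \<sigma> \<longleftrightarrow>
     \<sigma> \<subseteq> Vert \<T> \<and> \<not> is_face \<T> \<sigma> \<and> (\<forall>\<tau>. \<tau> \<subset> \<sigma> \<longrightarrow> is_face \<T> \<tau>)"

definition flag_triangulation :: "(real ^ 'n) set set \<Rightarrow> bool" where
  "flag_triangulation \<T> \<longleftrightarrow> (\<forall>\<sigma>. minimal_nonface \<T> \<sigma> \<longrightarrow> card \<sigma> = 2)"

definition normalized_volume :: "(real ^ 'n::finite) set \<Rightarrow> real" where
  "normalized_volume S = fact CARD('n) * measure lborel S"

definition unimodular_triangulation :: "(real ^ 'n::finite) set set \<Rightarrow> bool" where
  "unimodular_triangulation \<T> \<longleftrightarrow> (\<forall>S\<in>\<T>. normalized_volume S = 1)"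

end

theory Submission imports Defs begin

text \<open>
  Write \<open>v\<^sub>0, \<dots>, v\<^sub>d\<^sub>-\<^sub>1\<close> for the vertices of the simplex at height \<open>0\<close> and \<open>p\<^sub>l = (1, \<dots>, 1, l)\<close>, so
  that \<open>p\<^sub>N = a\<close> is the remaining vertex. The point \<open>p\<^sub>0\<close> is the barycentre of the face spanned by the
  \<open>M\<close> vertices \<open>v\<^sub>k\<close> with \<open>k \<in> K\<close>; here \<open>K\<close> contains all indices if \<open>M = d\<close> and all but \<open>0\<close> if
  \<open>M = d - 1\<close>. Starring the base at \<open>p\<^sub>0\<close> therefore gives \<open>M\<close> unimodular simplices, and slicing along
  the spine \<open>p\<^sub>0, \<dots>, p\<^sub>N\<close> gives the cells with vertices \<open>p\<^sub>j, p\<^sub>j\<^sub>+\<^sub>1\<close> and \<open>v\<^sub>k\<close> for \<open>k \<noteq> i\<close>, where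
  \<open>i \<in> K\<close> and \<open>j < N\<close>.

  The heights \<open>\<omega> p\<^sub>l = l\<^sup>2\<close> and \<open>\<omega> v\<^sub>k = 1\<close> induce this subdivision. If \<open>s\<^sub>i\<close> is the affine function that
  is \<open>1\<close> on the spine, \<open>M\<close> at \<open>v\<^sub>i\<close> and \<open>0\<close> at the other \<open>v\<^sub>k\<close>, then
  \<open>(2j + 1) x\<^sub>d + 1 - (j\<^sup>2 + j + 1) s\<^sub>i x\<close> lies below \<open>\<omega>\<close> on all vertices and agrees with it exactly on
  the cell \<open>(i, j)\<close>; on the spine the gap is \<open>(l - j) (l - j - 1)\<close>.
\<close>

section \<open>Integral affine bases\<close>

text \<open>\<open>int_vec.span\<close> is the integer lattice generated by a set; unimodularity is
  certified by showing that it contains all unit vectors.\<close>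

interpretation int_vec: module "(*s) :: int \<Rightarrow> int ^ 'n \<Rightarrow> int ^ 'n"
  by unfold_locales (simp_all add: vec_eq_iff algebra_simps)

text \<open>
  The volume formula \<open>content_simplex\<close> needs a well-ordered index type. This copy of the index type carries
  an arbitrary well-order, and \<open>measure_lborel_reindex\<close> moves the volume back.
\<close>

datatype 'a wo = Wo (unwo: 'a)

lemma UNIV_wo: "(UNIV :: 'a wo set) = Wo ` UNIV"
  using wo.exhaust_sel by blast

instance wo :: (finite) finite
  by standard (simp add: UNIV_wo)

lemma CARD_wo: "CARD('a wo) = CARD('a)"
  unfolding UNIV_wo by (rule card_image) (simp add: inj_def)

definition wo_rank :: "'a wo \<Rightarrow> nat" where
  "wo_rank = (SOME f. inj f)"

lemma inj_wo_rank: "inj (wo_rank :: 'a::finite wo \<Rightarrow> nat)"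
proof -
  have "\<exists>f :: 'a wo \<Rightarrow> nat. inj f"
    using finite_imp_inj_to_nat_seg[OF finite[of "UNIV :: 'a wo set"]] by blast
  then show ?thesis
    unfolding wo_rank_def by (rule someI_ex)
qed

instantiation wo :: (finite) wellorder
begin

definition "x \<le> y \<longleftrightarrow> wo_rank x \<le> wo_rank (y :: 'a wo)"
definition "x < y \<longleftrightarrow> wo_rank x < wo_rank (y :: 'a wo)"

instance
proof (intro_classes, goal_cases)
  case (1 x y)
  show ?case by (simp only: less_eq_wo_def less_wo_def less_le_not_le)
next
  case (2 x)
  show ?case by (simp only: less_eq_wo_def)
next
  case (3 x y z)
  then show ?case by (simp only: less_eq_wo_def)
next
  case (4 x y)
  then show ?case by (intro injD[OF inj_wo_rank]) (simp only: less_eq_wo_def)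
next
  case (5 x y)
  show ?case by (simp only: less_eq_wo_def linear)
next
  case (6 P a)
  show ?case
    by (rule measure_induct_rule[of wo_rank P a]) (rule 6, simp only: less_wo_def)
qed

end

section \<open>Passing from integer to real vectors\<close>

lemma real_vec_nth [simp]: "real_vec x $ k = of_int (x $ k)"
  by (simp add: real_vec_def)

lemma real_vec_diff: "real_vec (x - y) = real_vec x - real_vec y"
  by (simp add: vec_eq_iff)

lemma real_vec_0: "real_vec 0 = 0"
  and real_vec_add: "real_vec (x + y) = real_vec x + real_vec y"
  and real_vec_scale: "real_vec (c *s x) = of_int c *\<^sub>R real_vec x"
  by (simp_all add: vec_eq_iff)

lemma real_vec_sum: "real_vec (sum f A) = (\<Sum>x\<in>A. real_vec (f x))"
  by (induction A rule: infinite_finite_induct) (auto simp: real_vec_0 real_vec_add)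

lemma inj_real_vec: "inj real_vec"
  by (rule injI) (simp add: vec_eq_iff)

lemma real_vec_span:
  assumes "x \<in> int_vec.span S"
  shows "real_vec x \<in> span (real_vec ` S)"
  using assms
proof (induction rule: int_vec.span_induct)
  case base
  show ?case
    by (intro int_vec.subspaceI)
      (auto intro: span_add span_mul span_zero simp: real_vec_0 real_vec_add real_vec_scale)
next
  case (step x)
  then show ?case by (intro span_base) auto
qed

text \<open>The differences span the real space, so \<open>V\<close> has affine dimension d and thus
  at least d + 1 points; the upper bound then gives the exact count and independence. Bounding the
  size only from above means that coincidences among listed points need not be excluded
  beforehand.\<close>

lemma integral_affine_basis:
  fixes V :: "(int ^ 'n::finite) set"
  assumes V: "finite V" "card V \<le> Suc CARD('n)" "q \<in> V"
    and gen: "\<And>k. axis k 1 \<in> int_vec.span ((\<lambda>x. x - q) ` V)"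
  shows "\<not> affine_dependent (real_vec ` V)" "card V = Suc CARD('n)"
proof -
  let ?D = "(\<lambda>x. x - real_vec q) ` real_vec ` V"
  have D: "?D = real_vec ` (\<lambda>x. x - q) ` V"
    by (simp add: image_image real_vec_diff)
  have "axis k 1 \<in> span ?D" for k
  proof -
    have "axis k 1 = real_vec (axis k 1)"
      by (simp add: vec_eq_iff axis_def)
    then show ?thesis
      using real_vec_span[OF gen] D by metis
  qed
  then have "Basis \<subseteq> span ?D"
    by (auto simp: Basis_vec_def)
  then have "span ?D = UNIV"
    using span_mono[of Basis "span ?D"] by (simp only: span_span span_Basis) auto
  then have "dim ?D = DIM(real ^ 'n)"
    by (simp only: dim_eq_full)
  then have dim: "dim ?D = CARD('n)" by simp
  have "aff_dim (real_vec ` V) = int (dim ?D)"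
    using V(3) by (intro aff_dim_eq_dim_subtract hull_inc) auto
  then have aff_dim: "aff_dim (real_vec ` V) = int CARD('n)"
    using dim by simp
  have card: "card (real_vec ` V) = card V"
    by (intro card_image inj_on_subset[OF inj_real_vec]) auto
  show "card V = Suc CARD('n)"
    using aff_dim_le_card[of "real_vec ` V"] V(1,2) aff_dim card by simp
  then show "\<not> affine_dependent (real_vec ` V)"
    unfolding affine_independent_iff_card using V(1) aff_dim card by simp
qed

section \<open>Volume of a simplex with an integral affine basis\<close>

lemma prod_Basis_cart:
  "(\<Prod>b\<in>(Basis :: (real ^ 'n::finite) set). f b) = (\<Prod>i\<in>UNIV. f (axis i 1))"
proof -
  have Basis: "(Basis :: (real ^ 'n) set) = range (\<lambda>i. axis i 1)"
    by (auto simp: Basis_vec_def)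
  have inj: "inj (\<lambda>i::'n. axis i (1::real))"
    by (auto simp: inj_def axis_eq_axis)
  show ?thesis
    unfolding Basis by (subst prod.reindex[OF inj]) (simp add: o_def)
qed

text \<open>The preimage of a box under the relabelling is a box with the same side lengths in
  another order, and a measure with the right values on boxes is Lebesgue measure.\<close>

lemma measure_lborel_reindex:
  fixes \<pi> :: "'b::finite \<Rightarrow> 'a::finite" and S :: "(real ^ 'b) set"
  assumes \<pi>: "bij \<pi>" and S: "S \<in> sets borel"
  shows "measure lborel ((\<lambda>x :: real ^ 'a. \<chi> k. x $ \<pi> k) -` S) = measure lborel S"
proof -
  define r where "r = (\<lambda>x :: real ^ 'a. (\<chi> k. x $ \<pi> k) :: real ^ 'b)"
  define r' where "r' = (\<lambda>x :: real ^ 'b. (\<chi> i. x $ inv \<pi> i) :: real ^ 'a)"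
  have "continuous_on UNIV r"
    unfolding r_def by (intro continuous_on_vec_lambda continuous_intros)
  then have meas: "r \<in> borel_measurable borel"
    by (rule borel_measurable_continuous_onI)
  have all: "(\<forall>i. P i) \<longleftrightarrow> (\<forall>k. P (\<pi> k))" for P
    using \<pi> by (metis bij_pointE)
  have "lborel = distr lborel borel r"
  proof (rule lborel_eqI)
    fix l u :: "real ^ 'b"
    assume "\<And>b. b \<in> Basis \<Longrightarrow> l \<bullet> b \<le> u \<bullet> b"
    then have le: "l $ k \<le> u $ k" for k
      by (metis axis_in_Basis_iff cart_eq_inner_axis Basis_real_def insertI1)
    have vimage: "r -` box l u = box (r' l) (r' u)"
      using \<pi> by (auto simp: box_vec_eq_empty mem_box_cart r_def r'_def all bij_is_inj)
    have "emeasure (distr lborel borel r) (box l u) = emeasure lborel (box (r' l) (r' u))"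
      using meas by (subst emeasure_distr) (auto simp: vimage)
    also have "\<dots> = (\<Prod>b\<in>Basis. (r' u - r' l) \<bullet> b)"
      using le by (intro emeasure_lborel_box) (auto simp: Basis_vec_def inner_axis r'_def)
    also have "(\<Prod>b\<in>Basis. (r' u - r' l) \<bullet> b) = (\<Prod>i\<in>UNIV. u $ inv \<pi> i - l $ inv \<pi> i)"
      by (simp add: prod_Basis_cart inner_axis r'_def)
    also have "\<dots> = (\<Prod>k\<in>UNIV. u $ k - l $ k)"
      using bij_imp_bij_inv[OF \<pi>] by (rule prod.reindex_bij_betw)
    also have "\<dots> = prod ((\<bullet>) (u - l)) Basis"
      by (simp add: prod_Basis_cart inner_axis)
    finally show "emeasure (distr lborel borel r) (box l u) = ennreal (prod ((\<bullet>) (u - l)) Basis)" .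
  qed simp
  then have "measure lborel S = measure (distr lborel borel r) S"
    by simp
  also have "\<dots> = measure lborel (r -` S)"
    using meas S by (subst measure_distr) auto
  finally show ?thesis
    by (simp add: r_def)
qed

lemma det_of_int: "det (\<chi> i j. real_of_int (A $ i $ j)) = of_int (det A)"
  by (simp add: det_def)

lemma abs_det_integral_inverse:
  fixes A :: "int ^ 'n ^ 'n::finite"
  assumes "A ** B = mat 1"
  shows "\<bar>det A\<bar> = 1"
proof -
  have "det A * det B = 1"
    by (metis assms det_mul det_I)
  then show ?thesis
    using abs_zmult_eq_1 by (metis abs_one)
qed

text \<open>The edge vectors at \<open>q\<close> form an integer matrix. As they generate the
  lattice, it has an integer inverse, so its determinant is 1 or -1.\<close>

lemma normalized_volume_integral_affine_basis:
  fixes V :: "(int ^ 'n::finite) set"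
  assumes V: "finite V" "card V \<le> Suc CARD('n)" "q \<in> V"
    and gen: "\<And>k. axis k 1 \<in> int_vec.span ((\<lambda>x. x - q) ` V)"
  shows "normalized_volume (convex hull (real_vec ` V)) = 1"
proof -
  define r where "r = (\<lambda>x :: real ^ 'n. (\<chi> k. x $ unwo k) :: real ^ 'n wo)"
  have "bij (unwo :: 'n wo \<Rightarrow> 'n)"
    by (rule bij_betw_byWitness[where f' = Wo]) auto
  have lin: "linear r"
    by (rule linearI) (auto simp: r_def vec_eq_iff)
  have inj: "inj r"
    by (rule injI) (metis (mono_tags) r_def vec_lambda_beta vec_eq_iff wo.sel)
  define X where "X = r ` real_vec ` V"
  have "card (V - {q}) = CARD('n wo)"
    using integral_affine_basis(2)[OF assms] V by (simp add: CARD_wo)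
  then obtain f where f: "bij_betw f (UNIV :: 'n wo set) (V - {q})"
    using V(1) by (metis finite_Diff finite_same_card_bij finite)
  define A :: "int ^ 'n wo ^ 'n wo" where "A = (\<chi> i j. (f j - q) $ unwo i)"
  have "\<exists>B. A ** B = mat 1"
  proof -
    have "\<exists>c. axis k 1 = (\<Sum>j\<in>UNIV. c j *s (f j - q))" for k
    proof -
      have inj_diff: "inj_on (\<lambda>x. x - q) V" by (auto intro: inj_onI)
      have "axis k 1 \<in> range (\<lambda>c. \<Sum>v\<in>(\<lambda>x. x - q) ` V. c v *s v)"
        using gen[of k] V(1) by (simp add: int_vec.span_finite)
      then obtain c where "axis k 1 = (\<Sum>v\<in>(\<lambda>x. x - q) ` V. c v *s v)" by blast
      also have "\<dots> = (\<Sum>v\<in>V. c (v - q) *s (v - q))"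
        using inj_diff by (simp add: sum.reindex)
      \<comment> \<open>\<open>q\<close> contributes the zero vector; without it there is one edge
        vector per coordinate.\<close>
      also have "\<dots> = (\<Sum>v\<in>V - {q}. c (v - q) *s (v - q))"
        using V by (subst sum.remove[of V q]) auto
      also have "\<dots> = (\<Sum>j\<in>UNIV. c (f j - q) *s (f j - q))"
        by (rule sum.reindex_bij_betw[OF f, symmetric])
      finally show ?thesis by (intro exI)
    qed
    then obtain c where c: "\<And>k. axis k 1 = (\<Sum>j\<in>UNIV. c k j *s (f j - q))" by metis
    have "(A ** (\<chi> j k. c (unwo k) j)) $ i $ k = mat 1 $ i $ k" for i k
    proof -
      have "(A ** (\<chi> j k. c (unwo k) j)) $ i $ k = (\<Sum>j\<in>UNIV. c (unwo k) j *s (f j - q)) $ unwo i"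
        by (simp add: matrix_matrix_mult_def A_def algebra_simps)
      also have "\<dots> = mat 1 $ i $ k"
        unfolding c[symmetric] by (cases i; cases k) (simp add: axis_def mat_def)
      finally show ?thesis .
    qed
    then show ?thesis
      by (auto simp: vec_eq_iff)
  qed
  then have det_A: "\<bar>det A\<bar> = 1"
    using abs_det_integral_inverse by blast
  have inj_rV: "inj_on (\<lambda>v. r (real_vec v)) S" for S
    using inj inj_real_vec by (auto simp: inj_on_def)
  have X: "finite X" "card X = Suc CARD('n wo)" "r (real_vec q) \<in> X"
    using V integral_affine_basis(2)[OF assms] card_image[OF inj_rV, of V]
    by (auto simp: X_def image_image CARD_wo)
  have "bij_betw (\<lambda>j. r (real_vec (f j))) UNIV (X - {r (real_vec q)})"
  proof -
    have "(\<lambda>v. r (real_vec v)) ` (V - {q}) = X - {r (real_vec q)}"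
      unfolding X_def image_image using inj_rV[of UNIV] V(3)
      by (subst image_set_diff) auto
    then have "bij_betw (\<lambda>v. r (real_vec v)) (V - {q}) (X - {r (real_vec q)})"
      using inj_rV by (simp add: bij_betw_def)
    from bij_betw_trans[OF f this] show ?thesis by (simp add: comp_def)
  qed
  note content = content_simplex[OF X this]
  have "(\<chi> i j. r (real_vec (f j)) $ i - r (real_vec q) $ i) = (\<chi> i j. real_of_int (A $ i $ j))"
    by (simp add: vec_eq_iff A_def r_def)
  then have "measure lborel (convex hull X) = \<bar>of_int (det A)\<bar> / fact CARD('n)"
    using content by (simp add: det_of_int CARD_wo)
  then have vol: "measure lborel (convex hull X) = 1 / fact CARD('n)"
    using det_A by (metis of_int_1 of_int_abs)
  have "convex hull X = r ` (convex hull (real_vec ` V))"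
    unfolding X_def by (rule convex_hull_linear_image[OF lin, symmetric])
  then have "r -` (convex hull X) = convex hull (real_vec ` V)"
    by (simp add: inj_vimage_image_eq inj)
  moreover have "convex hull X \<in> sets borel"
    using X(1) by (intro borel_compact finite_imp_compact_convex_hull)
  then have "measure lborel (r -` (convex hull X)) = measure lborel (convex hull X)"
    unfolding r_def by (rule measure_lborel_reindex[OF \<open>bij unwo\<close>])
  ultimately show ?thesis
    by (simp add: normalized_volume_def vol)
qed

section \<open>Regular triangulations from supporting affine functions\<close>

lemma affine_of_convex_combination:
  fixes g :: "'a::real_inner"
  assumes "sum u S = 1"
  shows "g \<bullet> (\<Sum>v\<in>S. u v *\<^sub>R v) + c = (\<Sum>v\<in>S. u v * (g \<bullet> v + c))"
proof -
  have "(\<Sum>v\<in>S. u v * (g \<bullet> v + c)) = (\<Sum>v\<in>S. u v * (g \<bullet> v)) + (\<Sum>v\<in>S. u v) * c"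
    by (simp add: distrib_left sum.distrib sum_distrib_right)
  then show ?thesis
    using assms by (simp add: inner_sum_right)
qed

lemma convex_hull_affine_le:
  fixes g g' :: "'a::real_inner"
  assumes "finite S" "x \<in> convex hull S" "\<And>v. v \<in> S \<Longrightarrow> g \<bullet> v + c \<le> g' \<bullet> v + c'"
  shows "g \<bullet> x + c \<le> g' \<bullet> x + c'"
proof -
  obtain u where u: "\<forall>v\<in>S. 0 \<le> u v" "sum u S = 1" "(\<Sum>v\<in>S. u v *\<^sub>R v) = x"
    using assms(1,2) by (auto simp: convex_hull_finite)
  have "(\<Sum>v\<in>S. u v * (g \<bullet> v + c)) \<le> (\<Sum>v\<in>S. u v * (g' \<bullet> v + c'))"
    using u assms(3) by (intro sum_mono mult_left_mono) auto
  then show ?thesis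
    by (simp flip: u(3) add: affine_of_convex_combination[OF u(2)])
qed

text \<open>The slack at \<open>x\<close> is a weighted mean of nonnegative slacks, so if it
  vanishes, every point with positive slack has weight zero.\<close>

lemma convex_hull_affine_eq_subset:
  fixes g g' :: "'a::real_inner"
  assumes S: "finite S" and x: "x \<in> convex hull S"
    and le: "\<And>v. v \<in> S \<Longrightarrow> g \<bullet> v + c \<le> g' \<bullet> v + c'"
    and eq: "g \<bullet> x + c = g' \<bullet> x + c'"
  shows "x \<in> convex hull {v \<in> S. g \<bullet> v + c = g' \<bullet> v + c'}"
proof -
  let ?S = "{v \<in> S. g \<bullet> v + c = g' \<bullet> v + c'}"
  obtain u where u: "\<forall>v\<in>S. 0 \<le> u v" "sum u S = 1" "(\<Sum>v\<in>S. u v *\<^sub>R v) = x"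
    using S x by (auto simp: convex_hull_finite)
  have "(\<Sum>v\<in>S. u v * ((g' \<bullet> v + c') - (g \<bullet> v + c)))
      = (g' \<bullet> x + c') - (g \<bullet> x + c)"
    by (simp flip: u(3) add: affine_of_convex_combination[OF u(2)] right_diff_distrib sum_subtractf)
  also have "\<dots> = 0" using eq by simp
  finally have "\<forall>v\<in>S. u v * ((g' \<bullet> v + c') - (g \<bullet> v + c)) = 0"
    using S u(1) le by (subst (asm) sum_nonneg_eq_0_iff) auto
  then have z: "u v = 0" if "v \<in> S - ?S" for v
    using that by auto
  have "sum u ?S = 1"
    using u(2) z S by (subst sum.mono_neutral_left[of S]) auto
  moreover have "(\<Sum>v\<in>?S. u v *\<^sub>R v) = x"
    using u(3) z S by (subst sum.mono_neutral_left[of S]) auto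
  ultimately show ?thesis
    using S u(1) by (auto simp: convex_hull_finite intro!: exI[of _ u])
qed

text \<open>With a nonzero gradient, a short step from \<open>x\<close> against it would stay in
  \<open>S\<close> and make the function negative.\<close>

lemma affine_nonneg_near_zero:
  fixes g :: "'a::real_inner"
  assumes x: "x \<in> interior S" and nonneg: "\<And>y. y \<in> S \<Longrightarrow> 0 \<le> g \<bullet> y + c"
    and zero: "g \<bullet> x + c \<le> 0"
  shows "g = 0" "c = 0"
proof -
  obtain r where r: "r > 0" "ball x r \<subseteq> S"
    using x mem_interior by blast
  show g: "g = 0"
  proof (rule ccontr)
    assume "g \<noteq> 0"
    define t where "t = r / (2 * norm g)"
    have t: "t > 0" "t * norm g < r"
      using \<open>g \<noteq> 0\<close> r(1) by (auto simp: t_def)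
    then have "x - t *\<^sub>R g \<in> ball x r"
      by (simp add: dist_norm)
    then have "0 \<le> g \<bullet> (x - t *\<^sub>R g) + c"
      using r(2) nonneg by blast
    then have "t * (g \<bullet> g) \<le> 0"
      using zero by (simp add: inner_diff_right)
    then show False
      using t(1) inner_gt_zero_iff[of g] \<open>g \<noteq> 0\<close> by (simp add: mult_le_0_iff del: inner_gt_zero_iff)
  qed
  have "x \<in> S" using x interior_subset by blast
  then show "c = 0"
    using nonneg[of x] zero g by simp
qed

lemma aff_dim_graph:
  fixes g :: "'a::euclidean_space"
  assumes "F \<subseteq> {z. snd z = g \<bullet> fst z + c}"
  shows "aff_dim (fst ` F) = aff_dim F"
proof (rule antisym)
  show "aff_dim (fst ` F) \<le> aff_dim F"
    by (rule aff_dim_linear_image_le) (rule linear_fst)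
  have lin: "linear (\<lambda>x. (x, g \<bullet> x))"
    by (auto intro!: linearI simp: inner_add_right)
  have "F = (\<lambda>x. (x, g \<bullet> x + c)) ` fst ` F"
    using assms by (force simp: image_iff)
  also have "\<dots> = (+) (0, c) ` (\<lambda>x. (x, g \<bullet> x)) ` fst ` F"
    by (auto simp: image_image)
  finally have "aff_dim F = aff_dim ((\<lambda>x. (x, g \<bullet> x)) ` fst ` F)"
    using aff_dim_translation_eq by metis
  then show "aff_dim F \<le> aff_dim (fst ` F)"
    using aff_dim_linear_image_le[OF lin, of "fst ` F"] by simp
qed

text \<open>A face of the hull of a finite set is the hull of some of its points, and those must lie
  on the hyperplane.\<close>

lemma convex_hull_Int_supporting_hyperplane:
  fixes Z :: "'a::euclidean_space set"
  assumes "finite Z" "\<And>z. z \<in> Z \<Longrightarrow> u \<bullet> z \<le> \<beta>"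
  shows "convex hull Z \<subseteq> {z. u \<bullet> z \<le> \<beta>}"
    and "(convex hull Z \<inter> {z. u \<bullet> z = \<beta>}) face_of convex hull Z"
    and "convex hull Z \<inter> {z. u \<bullet> z = \<beta>} = convex hull {z \<in> Z. u \<bullet> z = \<beta>}"
proof -
  show le: "convex hull Z \<subseteq> {z. u \<bullet> z \<le> \<beta>}"
    using assms(2) by (intro hull_minimal) (auto intro: convex_halfspace_le)
  then show face: "(convex hull Z \<inter> {z. u \<bullet> z = \<beta>}) face_of convex hull Z"
    by (intro face_of_Int_supporting_hyperplane_le) auto
  show "convex hull Z \<inter> {z. u \<bullet> z = \<beta>} = convex hull {z \<in> Z. u \<bullet> z = \<beta>}" (is "?F = ?G")
  proof
    obtain Z' where Z': "Z' \<subseteq> Z" "?F = convex hull Z'"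
      using face_of_convex_hull_subset[OF finite_imp_compact[OF assms(1)] face] by blast
    then have "Z' \<subseteq> {z \<in> Z. u \<bullet> z = \<beta>}"
      using hull_subset[of Z' convex] by blast
    then show "?F \<subseteq> ?G"
      unfolding Z'(2) by (rule hull_mono)
    have "convex hull {z \<in> Z. u \<bullet> z = \<beta>} \<subseteq> {z. u \<bullet> z = \<beta>}"
      by (intro hull_minimal convex_hyperplane) auto
    then show "?G \<subseteq> ?F"
      using hull_mono[of "{z \<in> Z. u \<bullet> z = \<beta>}" Z convex] by auto
  qed
qed

lemma vertices_convex_hull:
  fixes W :: "(real ^ 'n::finite) set"
  assumes "\<not> affine_dependent W"
  shows "vertices (convex hull W) = W"
  using assms by (simp add: vertices_def extreme_point_of_convex_hull_affine_independent)

text \<open>A certificate of regularity: each cell has an affine function that stays below the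
  heights \<open>\<omega>\<close> at all vertices and touches them precisely at its own;
  \<open>cover\<close> rules out gaps.\<close>

locale supported_cells =
  fixes C :: "'c set" and W :: "'c \<Rightarrow> (real ^ 'n::finite) set"
    and \<omega> :: "real ^ 'n \<Rightarrow> real" and g :: "'c \<Rightarrow> real ^ 'n" and h :: "'c \<Rightarrow> real"
  assumes finite_C: "finite C"
    and indep: "c \<in> C \<Longrightarrow> \<not> affine_dependent (W c)"
    and card_W: "c \<in> C \<Longrightarrow> card (W c) = Suc CARD('n)"
    and below: "c \<in> C \<Longrightarrow> c' \<in> C \<Longrightarrow> x \<in> W c' \<Longrightarrow> g c \<bullet> x + h c \<le> \<omega> x"
    and touch: "c \<in> C \<Longrightarrow> c' \<in> C \<Longrightarrow> x \<in> W c' \<Longrightarrow> g c \<bullet> x + h c = \<omega> x \<longleftrightarrow> x \<in> W c"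
    and cover: "(\<Union>c\<in>C. convex hull W c) = convex hull (\<Union>c\<in>C. W c)"
begin

definition cells where "cells = (\<lambda>c. convex hull W c) ` C"

lemma finite_W: "c \<in> C \<Longrightarrow> finite (W c)"
  by (simp add: indep aff_independent_finite)

lemma touch_self: "c \<in> C \<Longrightarrow> x \<in> W c \<Longrightarrow> g c \<bullet> x + h c = \<omega> x"
  using touch by blast

text \<open>It suffices to compare at the vertices of \<open>c'\<close>, where its own function
  attains \<open>\<omega>\<close>. Hence the lifted surface is the maximum of the cell
  functions.\<close>

lemma affine_le_on_cell:
  assumes "c \<in> C" "c' \<in> C" "x \<in> convex hull W c'"
  shows "g c \<bullet> x + h c \<le> g c' \<bullet> x + h c'"
proof (rule convex_hull_affine_le[OF finite_W[OF assms(2)] assms(3)])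
  fix v assume v: "v \<in> W c'"
  show "g c \<bullet> v + h c \<le> g c' \<bullet> v + h c'"
    unfolding touch_self[OF assms(2) v] by (rule below[OF assms(1,2) v])
qed

lemma affine_eq_on_Int:
  assumes "c \<in> C" "c' \<in> C" "x \<in> convex hull W c" "x \<in> convex hull W c'"
  shows "g c' \<bullet> x + h c' = g c \<bullet> x + h c"
  using assms affine_le_on_cell by (intro antisym)

text \<open>At a common point the two functions dominate each other, hence agree. Only vertices of
  \<open>c\<close> where they agree can carry weight there, and at these the function of
  \<open>c'\<close> touches \<open>\<omega>\<close>, so they belong to \<open>c'\<close>
  too.\<close>

lemma convex_hull_Int:
  assumes "c \<in> C" "c' \<in> C"
  shows "convex hull W c \<inter> convex hull W c' = convex hull (W c \<inter> W c')"
proof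
  show "convex hull (W c \<inter> W c') \<subseteq> convex hull W c \<inter> convex hull W c'"
    by (simp add: hull_mono)
  show "convex hull W c \<inter> convex hull W c' \<subseteq> convex hull (W c \<inter> W c')"
  proof
    fix x assume x: "x \<in> convex hull W c \<inter> convex hull W c'"
    have "x \<in> convex hull {v \<in> W c. g c' \<bullet> v + h c' = g c \<bullet> v + h c}"
    proof (rule convex_hull_affine_eq_subset[OF finite_W[OF assms(1)]])
      show "x \<in> convex hull W c" using x by simp
      show "g c' \<bullet> x + h c' = g c \<bullet> x + h c"
        using x by (intro affine_eq_on_Int assms) simp_all
      show "g c' \<bullet> v + h c' \<le> g c \<bullet> v + h c" if "v \<in> W c" for v
        using assms that by (intro affine_le_on_cell hull_inc)
    qed
    moreover have "{v \<in> W c. g c' \<bullet> v + h c' = g c \<bullet> v + h c} \<subseteq> W c \<inter> W c'"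
    proof (intro subsetI)
      fix v assume v: "v \<in> {v \<in> W c. g c' \<bullet> v + h c' = g c \<bullet> v + h c}"
      then have "g c' \<bullet> v + h c' = \<omega> v"
        using touch_self[OF assms(1)] by simp
      then show "v \<in> W c \<inter> W c'"
        using v touch[OF assms(2,1)] by blast
    qed
    ultimately show "x \<in> convex hull (W c \<inter> W c')"
      using hull_mono by blast
  qed
qed

lemma triangulation_cells: "triangulation cells"
  unfolding triangulation_def
proof (intro conjI allI impI ballI)
  show "finite cells" by (simp add: cells_def finite_C)
next
  fix T assume "T \<in> cells"
  then obtain c where "c \<in> C" "T = convex hull W c" by (auto simp: cells_def)
  then have "(int (card (W c)) - 1) simplex T"
    using indep unfolding simplex_def by auto
  then show "\<exists>n. n simplex T" by blast
next
  fix T T' assume "T \<in> cells \<and> T' \<in> cells"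
  then obtain c c' where "c \<in> C" "c' \<in> C" "T = convex hull W c" "T' = convex hull W c'"
    by (auto simp: cells_def)
  then show "T \<inter> T' face_of T"
    by (auto simp: convex_hull_Int face_of_convex_hull_affine_independent[OF indep])
qed

lemma simplex_cells: "T \<in> cells \<Longrightarrow> int CARD('n) simplex T"
proof -
  assume "T \<in> cells"
  then obtain c where c: "c \<in> C" "T = convex hull W c" by (auto simp: cells_def)
  show ?thesis
    unfolding simplex_def by (rule exI[of _ "W c"]) (use c indep card_W in simp)
qed

lemma vertices_cell: "c \<in> C \<Longrightarrow> vertices (convex hull W c) = W c"
  by (simp add: indep vertices_convex_hull)

lemma Vert_cells: "Vert cells = (\<Union>c\<in>C. W c)"
  by (simp add: Vert_def cells_def vertices_cell)

text \<open>The graph of each cell function supports the lifted hull from below along that cell.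
  Conversely, the function of any full-dimensional lower face is shown to equal that of a cell
  containing an interior point of its projection.\<close>

lemma regular_cells: "regular_triangulation cells"
proof -
  define V where "V = (\<Union>c\<in>C. W c)"
  define Z where "Z = (\<lambda>v. (v, \<omega> v)) ` V"
  have fin: "finite V" "finite Z"
    using finite_C finite_W by (auto simp: V_def Z_def)
  have fst_Z: "fst ` {z \<in> Z. (a, -1) \<bullet> z = - c} = {v \<in> V. a \<bullet> v + c = \<omega> v}" for a and c :: real
    by (force simp: Z_def)
  have dim_W: "aff_dim (convex hull W c) = int CARD('n)" if "c \<in> C" for c
    using aff_dim_affine_independent[OF indep[OF that]] card_W[OF that]
    by (simp add: aff_dim_convex_hull)
  have touching: "{v \<in> V. g c \<bullet> v + h c = \<omega> v} = W c" if "c \<in> C" for c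
  proof (intro equalityI subsetI)
    fix v assume "v \<in> {v \<in> V. g c \<bullet> v + h c = \<omega> v}"
    then obtain c' where "c' \<in> C" "v \<in> W c'" "g c \<bullet> v + h c = \<omega> v" unfolding V_def by blast
    then show "v \<in> W c" using touch[OF that] by blast
  next
    fix v assume "v \<in> W c"
    then show "v \<in> {v \<in> V. g c \<bullet> v + h c = \<omega> v}" using touch[OF that that] that unfolding V_def by blast
  qed
  have upper: "fst ` F = convex hull {v \<in> V. a \<bullet> v + k = \<omega> v}" "aff_dim (fst ` F) = aff_dim F"
      "F face_of convex hull Z" "convex hull Z \<subseteq> {z. (a, -1) \<bullet> z \<le> - k}"
    if le: "\<And>v. v \<in> V \<Longrightarrow> a \<bullet> v + k \<le> \<omega> v" and F: "F = convex hull Z \<inter> {z. (a, -1) \<bullet> z = - k}"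
    for a k F
  proof -
    have le_Z: "(a, -1) \<bullet> z \<le> - k" if "z \<in> Z" for z
      using that le by (fastforce simp: Z_def)
    note supporting = convex_hull_Int_supporting_hyperplane[OF fin(2) le_Z]
    show "convex hull Z \<subseteq> {z. (a, -1) \<bullet> z \<le> - k}"
      by (rule supporting(1))
    show "F face_of convex hull Z"
      unfolding F by (rule supporting(2))
    have "fst ` F = fst ` (convex hull {z \<in> Z. (a, -1) \<bullet> z = - k})"
      unfolding F by (rule arg_cong[OF supporting(3)])
    also have "\<dots> = convex hull (fst ` {z \<in> Z. (a, -1) \<bullet> z = - k})"
      by (rule convex_hull_linear_image) (rule linear_fst)
    finally show "fst ` F = convex hull {v \<in> V. a \<bullet> v + k = \<omega> v}"
      unfolding fst_Z .
    have "F \<subseteq> {z. snd z = a \<bullet> fst z + k}"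
      unfolding F by (auto simp: inner_prod_def)
    then show "aff_dim (fst ` F) = aff_dim F"
      by (rule aff_dim_graph)
  qed
  have "cells = {fst ` F | F. F lower_face_of (convex hull Z) \<and> aff_dim F = int CARD('n)}" (is "_ = ?R")
  proof (intro equalityI subsetI)
    fix T assume "T \<in> cells"
    then obtain c where c: "c \<in> C" "T = convex hull W c" by (auto simp: cells_def)
    let ?F = "convex hull Z \<inter> {z. (g c, -1) \<bullet> z = - h c}"
    have le: "v \<in> V \<Longrightarrow> g c \<bullet> v + h c \<le> \<omega> v" for v
      using below c(1) by (auto simp: V_def)
    note F = upper[OF le refl]
    have fst_F: "fst ` ?F = T"
      using F(1) touching[OF c(1)] c(2) by simp
    moreover have "aff_dim ?F = int CARD('n)"
      using F(2) dim_W[OF c(1)] c(2) unfolding fst_F by simp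
    moreover have "snd (g c, - 1 :: real) < 0" by simp
    then have "?F lower_face_of convex hull Z"
      unfolding lower_face_of_def using F(3,4) by blast
    ultimately show "T \<in> ?R" by blast
  next
    fix T assume "T \<in> ?R"
    then obtain F u \<beta> where F: "T = fst ` F" "aff_dim F = int CARD('n)" "snd u < 0"
      "convex hull Z \<subseteq> {z. u \<bullet> z \<le> \<beta>}" "F = convex hull Z \<inter> {z. u \<bullet> z = \<beta>}"
      unfolding lower_face_of_def by blast
    \<comment> \<open>Dividing by the positive number \<open>- snd u\<close> makes the last
      coordinate of the normal -1, so the hyperplane becomes the graph of
      \<open>a \<bullet> x + k\<close>.\<close>
    define a where "a = (1 / - snd u) *\<^sub>R fst u"
    define k where "k = \<beta> / snd u"
    have u: "u \<bullet> z = \<beta> + - snd u * ((a, -1) \<bullet> z + k)" for z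
      using F(3) by (simp add: a_def k_def inner_prod_def field_simps)
    have le_iff: "u \<bullet> z \<le> \<beta> \<longleftrightarrow> (a, -1) \<bullet> z \<le> - k" and eq_iff: "u \<bullet> z = \<beta> \<longleftrightarrow> (a, -1) \<bullet> z = - k" for z
      unfolding u using F(3) by (auto simp: mult_le_0_iff zero_le_mult_iff)
    have le: "a \<bullet> v + k \<le> \<omega> v" if "v \<in> V" for v
    proof -
      have "(v, \<omega> v) \<in> convex hull Z"
        using that by (auto simp: Z_def intro: hull_inc)
      then show ?thesis
        using F(4) le_iff[of "(v, \<omega> v)"] by auto
    qed
    let ?W = "{v \<in> V. a \<bullet> v + k = \<omega> v}"
    have T: "T = convex hull ?W" and "aff_dim T = int CARD('n)"
      using upper[OF le, of F] F(1,2,5) eq_iff by auto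
    then have "interior T = rel_interior T"
      by (simp add: interior_rel_interior_gen)
    moreover have "T \<noteq> {}"
      using \<open>aff_dim T = int CARD('n)\<close> aff_dim_empty by force
    moreover have "rel_interior T = {} \<longleftrightarrow> T = {}"
      unfolding T by (intro rel_interior_eq_empty convex_convex_hull)
    ultimately have "interior T \<noteq> {}"
      by simp
    then obtain x where x: "x \<in> interior T"
      by blast
    then have "x \<in> T" using interior_subset by blast
    then have "x \<in> convex hull V"
      unfolding T using hull_mono[of ?W V convex] by auto
    then obtain c where c: "c \<in> C" "x \<in> convex hull W c"
      using cover unfolding V_def by blast
    \<comment> \<open>At the points of \<open>?W\<close>, which generate \<open>T\<close>, the
      function of the face attains \<open>\<omega>\<close>, which that of \<open>c\<close> does not
      exceed. At \<open>x\<close> the roles are exchanged.\<close>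
    have "0 \<le> (a - g c) \<bullet> y + (k - h c)" if "y \<in> T" for y
    proof -
      have "g c \<bullet> y + h c \<le> a \<bullet> y + k"
      proof (rule convex_hull_affine_le)
        show "finite ?W" using fin(1) by simp
        show "y \<in> convex hull ?W" using that T by simp
        fix v assume v: "v \<in> ?W"
        then obtain c' where "c' \<in> C" "v \<in> W c'" by (auto simp: V_def)
        then show "g c \<bullet> v + h c \<le> a \<bullet> v + k"
          using below[OF c(1)] v by auto
      qed
      then show ?thesis by (simp add: inner_diff_left)
    qed
    moreover have "(a - g c) \<bullet> x + (k - h c) \<le> 0"
    proof -
      have "a \<bullet> x + k \<le> g c \<bullet> x + h c"
      proof (rule convex_hull_affine_le[OF finite_W[OF c(1)] c(2)])
        fix v assume v: "v \<in> W c"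
        then have "v \<in> V" using c(1) by (auto simp: V_def)
        then show "a \<bullet> v + k \<le> g c \<bullet> v + h c"
          unfolding touch_self[OF c(1) v] by (rule le)
      qed
      then show ?thesis by (simp add: inner_diff_left)
    qed
    \<comment> \<open>The affine difference is nonnegative near the interior point \<open>x\<close> and vanishes there.\<close>
    ultimately have "a = g c" "k = h c"
      using affine_nonneg_near_zero[OF x, of "a - g c" "k - h c"] by auto
    then show "T \<in> cells"
      unfolding T using touching[OF c(1)] c(1) by (auto simp: cells_def)
  qed
  then show ?thesis
    unfolding regular_triangulation_def Vert_cells V_def[symmetric] Z_def by blast
qed

end

section \<open>The triangulation of the simplex\<close>

text \<open>The left side is the secant of the square function through j and j + 1, and no integer
  lies strictly between these.\<close>

lemma lattice_gap:
  fixes l j :: nat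
  shows "(2 * real j + 1) * real l - (real j ^ 2 + real j) \<le> (real l)\<^sup>2"
    and "(2 * real j + 1) * real l - (real j ^ 2 + real j) = (real l)\<^sup>2 \<longleftrightarrow> l = j \<or> l = Suc j"
proof -
  have eq: "(real l)\<^sup>2 - ((2 * real j + 1) * real l - (real j ^ 2 + real j))
      = (real l - real j) * (real l - real (Suc j))"
    by (simp add: power2_eq_square algebra_simps)
  have "l \<le> j \<or> Suc j \<le> l" by auto
  then have "0 \<le> (real l - real j) * (real l - real (Suc j))"
    by (auto intro: mult_nonneg_nonneg mult_nonpos_nonpos)
  then show "(2 * real j + 1) * real l - (real j ^ 2 + real j) \<le> (real l)\<^sup>2"
    using eq by linarith
  have "(real l - real j) * (real l - real (Suc j)) = 0 \<longleftrightarrow> l = j \<or> l = Suc j"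
    by (simp only: mult_eq_0_iff right_minus_eq of_nat_eq_iff)
  then show "(2 * real j + 1) * real l - (real j ^ 2 + real j) = (real l)\<^sup>2 \<longleftrightarrow> l = j \<or> l = Suc j"
    using eq by linarith
qed

section \<open>Base vertices and spine in coordinates\<close>

locale hnf =
  fixes d :: nat and e :: "nat \<Rightarrow> 'n::finite" and M :: int and N :: nat
  assumes dim: "CARD('n) = d" and bij: "bij_betw e {1..d} UNIV" and d2: "2 \<le> d" and N: "0 < N"
    and M: "M = int d - 1 \<or> M = int d"
begin

definition p :: "nat \<Rightarrow> int ^ 'n" where
  "p l = (\<chi> c. if c = e d then int l else 1)"

definition v :: "nat \<Rightarrow> int ^ 'n" where
  "v k = (if k = 0 then 0 else if k < d - 1 then axis (e k) 1
          else (\<chi> c. if c = e d then 0 else if c = e (d - 1) then M else M - 1))"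

definition K :: "nat set" where
  "K = (if M = int d then {..<d} else {1..<d})"

lemma e_eq_iff: "k \<in> {1..d} \<Longrightarrow> l \<in> {1..d} \<Longrightarrow> e k = e l \<longleftrightarrow> k = l"
  by (rule inj_on_eq_iff[OF bij_betw_imp_inj_on[OF bij]])

lemma vec_eq_e: "x = y \<longleftrightarrow> (\<forall>k\<in>{1..d}. x $ e k = y $ e k)"
proof
  assume *: "\<forall>k\<in>{1..d}. x $ e k = y $ e k"
  have "x $ c = y $ c" for c
  proof -
    have "c \<in> e ` {1..d}" using bij_betw_imp_surj_on[OF bij] by simp
    then show ?thesis using * by blast
  qed
  then show "x = y" by (simp add: vec_eq_iff)
qed simp

lemma p_nth: "k \<in> {1..d} \<Longrightarrow> p l $ e k = (if k = d then int l else 1)"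
  using d2 by (simp add: p_def e_eq_iff)

lemma v_nth: "k \<in> {1..d} \<Longrightarrow> j < d \<Longrightarrow> v j $ e k =
    (if j = 0 then 0 else if j < d - 1 then if k = j then 1 else 0
     else if k = d then 0 else if k = d - 1 then M else M - 1)"
  using d2 by (auto simp: v_def axis_def e_eq_iff)

lemma v_0: "v 0 = 0"
  by (simp add: v_def)

lemma finite_K: "finite K" and K_subset: "K \<subseteq> {..<d}" and K_pos: "{1..<d} \<subseteq> K"
  by (auto simp: K_def)

lemma card_K: "int (card K) = M"
  using M d2 by (auto simp: K_def of_nat_diff)

lemma real_card_K: "real (card K) = of_int M"
  by (metis card_K of_int_of_nat_eq)

lemma M_pos: "0 < M"
  using M d2 by auto

text \<open>In coordinates before d - 1, \<open>v (d - 1)\<close> gives M - 1 and one unit vector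
  the missing 1; in coordinate d - 1 only \<open>v (d - 1)\<close> contributes. Index 0 adds the
  zero vector, so both values of M are covered at once.\<close>

lemma sum_v: "(\<Sum>k\<in>K. v k) = M *s p 0"
proof -
  have "(\<Sum>k\<in>K. v k) = (\<Sum>k\<in>{1..<d}. v k)"
  proof (intro sum.mono_neutral_right finite_K K_pos ballI)
    fix k assume "k \<in> K - {1..<d}"
    then have "k = 0" using K_subset by auto
    then show "v k = 0" by (simp add: v_0)
  qed
  also have "\<dots> = v (d - 1) + (\<Sum>k\<in>{1..<d - 1}. v k)"
  proof -
    have "{1..<d} = insert (d - 1) {1..<d - 1}" using d2 by auto
    then show ?thesis by simp
  qed
  also have "\<dots> = M *s p 0"
    unfolding vec_eq_e
  proof
    fix m assume m: "m \<in> {1..d}"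
    have "(\<Sum>k\<in>{1..<d - 1}. v k $ e m) = (\<Sum>k\<in>{1..<d - 1}. if m = k then 1 else 0)"
      using m by (intro sum.cong) (auto simp: v_nth)
    also have "\<dots> = (if m \<in> {1..<d - 1} then 1 else 0)"
      by (simp add: sum.delta)
    finally show "(v (d - 1) + (\<Sum>k\<in>{1..<d - 1}. v k)) $ e m = (M *s p 0) $ e m"
      using m d2 by (auto simp: v_nth p_nth)
  qed
  finally show ?thesis .
qed

lemma p_Suc: "p (Suc l) = p l + axis (e d) 1"
  by (simp add: p_def vec_eq_iff axis_def)

lemma p_add: "p l = p 0 + int l *s axis (e d) 1"
  by (simp add: p_def vec_eq_iff axis_def)

lemma inj_p: "p l = p l' \<longleftrightarrow> l = l'"
  by (auto simp: p_def vec_eq_iff)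

section \<open>Barycentric forms of the base\<close>

definition bary :: "nat \<Rightarrow> real ^ 'n" where
  "bary k = (if k = d - 1 then axis (e (d - 1)) 1
             else of_int M *\<^sub>R axis (e k) 1 - (of_int M - 1) *\<^sub>R axis (e (d - 1)) 1)"

text \<open>For positive k, \<open>bary k\<close> is M times the barycentric coordinate of
  \<open>v k\<close> in the base, extended constantly in the spine direction. These coordinates sum
  to 1, so index 0 receives M minus the others; \<open>facet_const\<close> supplies that M.\<close>

definition facet_grad :: "nat \<Rightarrow> real ^ 'n" where
  "facet_grad i = (if i = 0 then - (\<Sum>k\<in>{1..<d}. bary k) else bary i)"

definition facet_const :: "nat \<Rightarrow> real" where
  "facet_const i = (if i = 0 then of_int M else 0)"

definition facet_form :: "nat \<Rightarrow> real ^ 'n \<Rightarrow> real" where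
  "facet_form i x = facet_grad i \<bullet> x + facet_const i"

lemma axis_inner: "axis k 1 \<bullet> (x :: real ^ 'n) = x $ k"
  by (simp add: inner_axis')

lemma bary_v:
  assumes "k \<in> {1..<d}" "j < d"
  shows "bary k \<bullet> real_vec (v j) = (if j = k then of_int M else 0)"
proof -
  have k: "k \<in> {1..d}" "d - 1 \<in> {1..d}" using assms d2 by auto
  show ?thesis
    using assms v_nth[OF k(1) assms(2)] v_nth[OF k(2) assms(2)] d2
    by (auto simp: bary_def axis_inner inner_diff_left)
qed

lemma bary_p:
  assumes "k \<in> {1..<d}"
  shows "bary k \<bullet> real_vec (p l) = 1"
proof -
  have k: "k \<in> {1..d}" "d - 1 \<in> {1..d}" using assms d2 by auto
  show ?thesis
    using assms p_nth[OF k(1)] p_nth[OF k(2)] d2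
    by (auto simp: bary_def axis_inner inner_diff_left)
qed

lemma facet_form_v:
  assumes "i < d" "j < d"
  shows "facet_form i (real_vec (v j)) = (if i = j then of_int M else 0)"
proof (cases "i = 0")
  case True
  have "(\<Sum>k\<in>{1..<d}. bary k \<bullet> real_vec (v j)) = (\<Sum>k\<in>{1..<d}. if j = k then of_int M else 0)"
    using assms by (intro sum.cong) (auto simp: bary_v)
  also have "\<dots> = (if j \<in> {1..<d} then of_int M else 0)"
    by (simp add: sum.delta)
  finally show ?thesis
    using True assms by (auto simp: facet_form_def facet_grad_def facet_const_def inner_sum_left)
next
  case False
  then show ?thesis
    using assms bary_v[of i j] by (auto simp: facet_form_def facet_grad_def facet_const_def)
qed

text \<open>For i = 0 the value is M - (d - 1), and 0 lies in \<open>K\<close> only when M =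
  d.\<close>

lemma facet_form_p:
  assumes "i \<in> K"
  shows "facet_form i (real_vec (p l)) = 1"
proof (cases "i = 0")
  case True
  have "(\<Sum>k\<in>{1..<d}. bary k \<bullet> real_vec (p l)) = (\<Sum>k\<in>{1..<d}. 1)"
    by (intro sum.cong refl bary_p)
  then show ?thesis
    using True assms d2 by (auto simp: facet_form_def facet_grad_def facet_const_def inner_sum_left K_def of_nat_diff split: if_splits)
next
  case False
  then show ?thesis
    using assms bary_p[of i l] K_subset by (auto simp: facet_form_def facet_grad_def facet_const_def)
qed

lemma inj_v: "inj_on v {..<d}"
proof (rule inj_onI)
  fix i j assume *: "i \<in> {..<d}" "j \<in> {..<d}" "v i = v j"
  then show "i = j"
    using facet_form_v[of i i] facet_form_v[of i j] M_pos by (auto split: if_splits)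
qed

section \<open>Cells, heights and supporting functions\<close>

definition cell_points :: "nat \<times> nat \<Rightarrow> (int ^ 'n) set" where
  "cell_points c = {p (snd c), p (Suc (snd c))} \<union> v ` ({..<d} - {fst c})"

definition W :: "nat \<times> nat \<Rightarrow> (real ^ 'n) set" where
  "W c = real_vec ` cell_points c"

definition C :: "(nat \<times> nat) set" where
  "C = K \<times> {..<N}"

text \<open>
  The spine takes precedence in \<open>\<omega>\<close> because \<open>v 1 = p 0\<close> when \<open>d = 2\<close> and \<open>M = 1\<close>.
\<close>

definition \<omega> :: "real ^ 'n \<Rightarrow> real" where
  "\<omega> x = (if x \<in> real_vec ` range p then (x $ e d)\<^sup>2 else 1)"

text \<open>On the spine the facet form is 1, so the coefficient j^2 + j + 1 turns the function into
  the secant (2j + 1) l - (j^2 + j) of l^2. At base vertices other than \<open>v i\<close> the form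
  vanishes and the value is 1.\<close>

definition g :: "nat \<times> nat \<Rightarrow> real ^ 'n" where
  "g c = (2 * real (snd c) + 1) *\<^sub>R axis (e d) 1
         - (real (snd c) ^ 2 + real (snd c) + 1) *\<^sub>R facet_grad (fst c)"

definition h :: "nat \<times> nat \<Rightarrow> real" where
  "h c = 1 - (real (snd c) ^ 2 + real (snd c) + 1) * facet_const (fst c)"

lemma g_h: "g (i, j) \<bullet> x + h (i, j) =
    (2 * real j + 1) * x $ e d + 1 - (real j ^ 2 + real j + 1) * facet_form i x"
  by (simp add: g_def h_def facet_form_def inner_diff_left axis_inner algebra_simps)

lemma p_height: "p l $ e d = int l"
  by (simp add: p_def)

lemma v_height: "k < d \<Longrightarrow> v k $ e d = 0"
  using v_nth[of d k] d2 by simp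

lemma p_neq_v: "0 < l \<Longrightarrow> k < d \<Longrightarrow> p l \<noteq> v k"
  using p_height[of l] v_height[of k] by force

text \<open>Facet form i is 1 on the spine and 0 at the base vertices kept in the cell, so none of
  these is a spine point.\<close>

lemma p_in_cell:
  assumes "i \<in> K"
  shows "p l \<in> cell_points (i, j) \<longleftrightarrow> l = j \<or> l = Suc j"
proof -
  have "p l \<noteq> v k" if "k < d" "k \<noteq> i" for k
    using facet_form_p[OF assms, of l] facet_form_v[of i k] that assms K_subset by auto
  then show ?thesis
    by (auto simp: cell_points_def inj_p)
qed

text \<open>Excluding \<open>range p\<close> avoids the coincidence \<open>v 1 = p 0\<close> for d =
  2 and M = 1: that point lies in the cell (1, 0) although k = i.\<close>

lemma v_in_cell:
  assumes "i \<in> K" "k < d" "v k \<notin> range p"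
  shows "v k \<in> cell_points (i, j) \<longleftrightarrow> k \<noteq> i"
  using assms inj_v K_subset by (auto simp: cell_points_def inj_on_def)

lemma in_W_iff: "real_vec x \<in> W c \<longleftrightarrow> x \<in> cell_points c"
  by (simp add: W_def inj_image_mem_iff[OF inj_real_vec])

text \<open>On the spine this is \<open>lattice_gap\<close>. Off the spine the gap vanishes except
  at \<open>v i\<close>, where it is (j^2 + j + 1) M > 0.\<close>

lemma support:
  assumes "c \<in> C" "c' \<in> C" "x \<in> W c'"
  shows "g c \<bullet> x + h c \<le> \<omega> x \<and> (g c \<bullet> x + h c = \<omega> x \<longleftrightarrow> x \<in> W c)"
proof -
  obtain i j where c: "c = (i, j)" "i \<in> K" "i < d"
    using assms(1) K_subset by (auto simp: C_def)
  obtain y where y: "x = real_vec y" "y \<in> cell_points c'"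
    using assms(3) by (auto simp: W_def)
  show ?thesis
  proof (cases "y \<in> range p")
    case True
    then obtain l where l: "y = p l" by auto
    have "\<omega> x = (real l)\<^sup>2"
      by (simp add: \<omega>_def y l p_height)
    moreover have "g c \<bullet> x + h c = (2 * real j + 1) * real l - (real j ^ 2 + real j)"
      unfolding c(1) g_h by (simp only: y l real_vec_nth p_height facet_form_p[OF c(2)]) simp
    moreover have "x \<in> W c \<longleftrightarrow> l = j \<or> l = Suc j"
      unfolding y l in_W_iff c(1) by (rule p_in_cell[OF c(2)])
    ultimately show ?thesis
      using lattice_gap[of j l] by simp
  next
    case False
    then obtain k where k: "y = v k" "k < d"
      using y(2) by (auto simp: cell_points_def)
    have "\<omega> x = 1"
      using False by (auto simp: \<omega>_def y inj_eq[OF inj_real_vec])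
    moreover have "g c \<bullet> x + h c
        = 1 - (real j ^ 2 + real j + 1) * (if i = k then of_int M else 0)"
      unfolding c(1) g_h by (simp only: y k real_vec_nth v_height[OF k(2)] facet_form_v[OF c(3) k(2)])
    moreover have "x \<in> W c \<longleftrightarrow> k \<noteq> i"
      unfolding y(1) k(1) in_W_iff c(1) by (rule v_in_cell[OF c(2) k(2)]) (use False k in simp)
    moreover have "0 < (real j ^ 2 + real j + 1) * of_int M"
      using M_pos by (intro mult_pos_pos) (auto intro: add_nonneg_pos)
    ultimately show ?thesis
      by auto
  qed
qed

section \<open>Unimodularity of the cells\<close>

lemma axis_in_span_cell:
  assumes "(i, j) \<in> C"
  shows "axis c 1 \<in> int_vec.span ((\<lambda>x. x - p j) ` cell_points (i, j))" (is "_ \<in> ?G")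
proof -
  have i: "i \<in> K" using assms by (simp add: C_def)
  have base: "x \<in> cell_points (i, j) \<Longrightarrow> x - p j \<in> ?G" for x
    by (intro int_vec.span_base) auto
  have "p (Suc j) - p j \<in> ?G"
    by (rule base) (simp add: cell_points_def)
  then have e_d: "axis (e d) 1 \<in> ?G"
    by (simp add: p_Suc)
  then have "int j *s axis (e d) 1 \<in> ?G"
    by (rule int_vec.span_scale)
  \<comment> \<open>This moves the base point from \<open>p j\<close> down to \<open>p 0\<close>,
    where the barycentre relation applies.\<close>
  then have p_j: "p j - p 0 \<in> ?G"
    using p_add[of j] by simp
  have u: "v k - p 0 \<in> ?G" if "k < d" "k \<noteq> i" for k
  proof -
    have "v k - p j \<in> ?G"
      using that by (intro base) (auto simp: cell_points_def)
    from int_vec.span_add[OF this p_j] show ?thesis by simp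
  qed
  \<comment> \<open>The vectors \<open>v k - p 0\<close> with \<open>k \<in> K\<close> sum to zero, which recovers the one left out of the cell.\<close>
  have "v i - p 0 \<in> ?G"
  proof -
    have "(\<Sum>k\<in>K. p 0) $ c = (int (card K) *s p 0) $ c" for c
      by (subst sum_component) simp
    then have "(\<Sum>k\<in>K. v k - p 0) = (\<Sum>k\<in>K. v k) - int (card K) *s p 0"
      by (simp only: sum_subtractf vec_eq_iff) simp
    also have "\<dots> = 0"
      by (simp add: sum_v card_K)
    finally have "v i - p 0 = - (\<Sum>k\<in>K - {i}. v k - p 0)"
      using sum.remove[OF finite_K i, of "\<lambda>k. v k - p 0"] by (simp add: eq_neg_iff_add_eq_0)
    moreover have "(\<Sum>k\<in>K - {i}. v k - p 0) \<in> ?G"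
      using K_subset by (intro int_vec.span_sum u) auto
    ultimately show ?thesis
      by (simp add: int_vec.span_neg)
  qed
  then have u: "v k - p 0 \<in> ?G" if "k < d" for k
    using u that by (cases "k = i") auto
  \<comment> \<open>As \<open>v 0\<close> is zero, its difference is \<open>- p 0\<close>; from here
    on differences yield the points themselves.\<close>
  have p_0: "p 0 \<in> ?G"
    using int_vec.span_neg[OF u[of 0]] d2 by (simp add: v_0)
  have v: "v k \<in> ?G" if "k < d" for k
    using int_vec.span_add[OF u[OF that] p_0] by simp
  have "c \<in> e ` {1..d}" using bij_betw_imp_surj_on[OF bij] by simp
  then obtain k where k: "c = e k" "k \<in> {1..d}" by auto
  consider "k = d" | "k = d - 1" "k < d" | "k < d - 1"
    using k by force
  then show ?thesis
  proof cases
    case 1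
    then show ?thesis using e_d k by simp
  next
    case 2
    \<comment> \<open>Subtracting M - 1 copies of \<open>p 0\<close> clears the first d - 2 entries
      of \<open>v (d - 1)\<close> and leaves M - (M - 1) = 1 in the next.\<close>
    have "axis (e (d - 1)) 1 = v (d - 1) - (M - 1) *s p 0"
      unfolding vec_eq_e using d2 by (auto simp: v_nth p_nth axis_def e_eq_iff)
    moreover have "v (d - 1) - (M - 1) *s p 0 \<in> ?G"
      using d2 by (intro int_vec.span_diff int_vec.span_scale v p_0) auto
    ultimately show ?thesis using 2 k by simp
  next
    case 3
    then have "axis c 1 = v k" using k by (simp add: v_def)
    then show ?thesis using v 3 by simp
  qed
qed

lemma finite_cell_points: "finite (cell_points c)"
  by (simp add: cell_points_def)

lemma card_cell_points:
  assumes "c \<in> C"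
  shows "card (cell_points c) \<le> Suc CARD('n)"
proof -
  have "fst c < d" using assms K_subset by (auto simp: C_def)
  then have "card ({..<d} - {fst c}) = d - 1" by simp
  then have "card (v ` ({..<d} - {fst c})) \<le> d - 1"
    by (metis card_image_le finite_Diff finite_lessThan)
  moreover have "card {p (snd c), p (Suc (snd c))} \<le> 2"
    by (simp add: card_insert_if)
  moreover have "card (cell_points c)
      \<le> card {p (snd c), p (Suc (snd c))} + card (v ` ({..<d} - {fst c}))"
    unfolding cell_points_def by (rule card_Un_le)
  ultimately show ?thesis using d2 dim by linarith
qed

lemma
  assumes "c \<in> C"
  shows cell_indep: "\<not> affine_dependent (W c)"
    and cell_card: "card (W c) = Suc CARD('n)"
    and cell_volume: "normalized_volume (convex hull W c) = 1"
proof -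
  have q: "p (snd c) \<in> cell_points c"
    by (simp add: cell_points_def)
  have gen: "axis k 1 \<in> int_vec.span ((\<lambda>x. x - p (snd c)) ` cell_points c)" for k
    using axis_in_span_cell[of "fst c" "snd c" k] assms by simp
  note prems = finite_cell_points card_cell_points[OF assms] q gen
  show "\<not> affine_dependent (W c)" "normalized_volume (convex hull W c) = 1"
    unfolding W_def by (rule integral_affine_basis normalized_volume_integral_affine_basis prems)+
  show "card (W c) = Suc CARD('n)"
    unfolding W_def using integral_affine_basis(2)[OF prems]
    by (subst card_image) (auto intro: inj_on_subset[OF inj_real_vec])
qed

section \<open>Covering the simplex by the cells\<close>

definition S :: "(real ^ 'n) set" where
  "S = convex hull (real_vec ` insert (p N) (v ` {..<d}))"

lemma sum_v_real: "(\<Sum>k\<in>K. real_vec (v k)) = of_int M *\<^sub>R real_vec (p 0)"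
  using arg_cong[OF sum_v, of real_vec] by (simp add: real_vec_sum real_vec_scale)

lemma p_add_real: "real_vec (p l) = real_vec (p 0) + real l *\<^sub>R axis (e d) 1"
  by (simp add: vec_eq_iff p_def axis_def)

lemma p_in_S: "l \<le> N \<Longrightarrow> real_vec (p l) \<in> S"
proof -
  assume l: "l \<le> N"
  have conv: "convex S" by (simp add: S_def)
  have "real_vec (v k) \<in> S" if "k \<in> K" for k
    unfolding S_def using that K_subset by (intro hull_inc) auto
  then have "(\<Sum>k\<in>K. (1 / of_int M) *\<^sub>R real_vec (v k)) \<in> S"
    using M_pos by (intro convex_sum finite_K conv) (simp_all add: real_card_K)
  also have "(\<Sum>k\<in>K. (1 / of_int M) *\<^sub>R real_vec (v k)) = real_vec (p 0)"
    using M_pos by (simp add: sum_v_real flip: scaleR_sum_right)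
  finally have p_0: "real_vec (p 0) \<in> S" .
  have p_N: "real_vec (p N) \<in> S"
    unfolding S_def by (intro hull_inc) auto
  have "(1 - real l / real N) *\<^sub>R real_vec (p 0) + (real l / real N) *\<^sub>R real_vec (p N) \<in> S"
    using l N by (intro convexD_alt[OF conv p_0 p_N]) auto
  also have "(1 - real l / real N) *\<^sub>R real_vec (p 0) + (real l / real N) *\<^sub>R real_vec (p N)
      = real_vec (p l)"
    using N by (simp add: p_add_real[of N] p_add_real[of l] algebra_simps)
  finally show ?thesis .
qed

lemma W_subset_S:
  assumes "c \<in> C"
  shows "W c \<subseteq> S"
proof -
  have "real_vec (p (snd c)) \<in> S" "real_vec (p (Suc (snd c))) \<in> S"
    using assms by (auto simp: C_def intro!: p_in_S)
  moreover have "real_vec (v k) \<in> S" if "k < d" for k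
    unfolding S_def using that by (intro hull_inc) auto
  ultimately show ?thesis
    by (auto simp: W_def cell_points_def)
qed

text \<open>\<open>z\<close> is the spine point at height r / t. Stating the equation multiplied by
  t admits weight t = 0, which forces r = 0.\<close>

lemma segment_cell:
  fixes t r :: real
  assumes "0 \<le> t" "0 \<le> r" "r \<le> real N * t"
  obtains j z where "j < N" "z \<in> closed_segment (real_vec (p j)) (real_vec (p (Suc j)))"
    "t *\<^sub>R z = t *\<^sub>R real_vec (p 0) + r *\<^sub>R axis (e d) 1"
proof (cases "t = 0")
  case True
  then show ?thesis
    using assms N by (intro that[of 0 "real_vec (p 0)"]) auto
next
  case False
  define q where "q = r / t"
  have q: "0 \<le> q" "q \<le> real N" "t * q = r"
    using assms False by (auto simp: q_def divide_simps mult.commute)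
  \<comment> \<open>The cap at N - 1 covers q = N, whose floor would select a segment past the end
    of the spine.\<close>
  define j where "j = min (nat \<lfloor>q\<rfloor>) (N - 1)"
  have "j < N" using N by (auto simp: j_def)
  have "real (nat \<lfloor>q\<rfloor>) \<le> q" "q \<le> real (nat \<lfloor>q\<rfloor>) + 1"
    using q(1) by linarith+
  then have j: "real j \<le> q" "q \<le> real j + 1"
    using q(2) N unfolding j_def by (auto simp: min_def of_nat_diff)
  define z where "z = (1 - (q - real j)) *\<^sub>R real_vec (p j) + (q - real j) *\<^sub>R real_vec (p (Suc j))"
  have "z \<in> closed_segment (real_vec (p j)) (real_vec (p (Suc j)))"
    unfolding z_def closed_segment_def using j by (intro CollectI exI[of _ "q - real j"]) auto
  moreover have "z = real_vec (p 0) + q *\<^sub>R axis (e d) 1"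
    by (simp add: z_def p_add_real[of j] p_add_real[of "Suc j"] algebra_simps)
  then have "t *\<^sub>R z = t *\<^sub>R real_vec (p 0) + r *\<^sub>R axis (e d) 1"
    by (simp add: scaleR_add_right q(3))
  ultimately show ?thesis
    using that \<open>j < N\<close> by blast
qed

lemma S_subset_cells: "S \<subseteq> (\<Union>c\<in>C. convex hull W c)"
proof
  fix x assume "x \<in> S"
  define X where "X = real_vec ` v ` {..<d}"
  have inj: "inj_on (\<lambda>k. real_vec (v k)) {..<d}"
    using inj_v inj_real_vec by (auto simp: inj_on_def)
  have X: "finite X" "real_vec (p N) \<notin> X"
    using p_neq_v[OF N] by (auto simp: X_def inj_eq[OF inj_real_vec])
  obtain u where u: "\<forall>y\<in>insert (real_vec (p N)) X. 0 \<le> u y" "sum u (insert (real_vec (p N)) X) = 1"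
    "(\<Sum>y\<in>insert (real_vec (p N)) X. u y *\<^sub>R y) = x"
    using \<open>x \<in> S\<close> X(1) unfolding S_def image_insert X_def[symmetric]
    by (subst (asm) convex_hull_finite) auto
  define \<alpha> where "\<alpha> k = u (real_vec (v k))" for k
  define \<gamma> where "\<gamma> = u (real_vec (p N))"
  have \<alpha>0: "0 \<le> \<alpha> k" if "k < d" for k
    using u(1) that by (auto simp: \<alpha>_def X_def)
  have \<gamma>0: "0 \<le> \<gamma>" using u(1) by (simp add: \<gamma>_def)
  have sum1: "(\<Sum>k<d. \<alpha> k) + \<gamma> = 1"
    using u(2) X inj by (simp add: X_def \<alpha>_def \<gamma>_def image_image sum.reindex)
  have x: "x = (\<Sum>k<d. \<alpha> k *\<^sub>R real_vec (v k)) + \<gamma> *\<^sub>R real_vec (p N)"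
    using u(3) X inj by (simp add: X_def \<alpha>_def \<gamma>_def image_image sum.reindex add.commute)
  have "K \<noteq> {}" using card_K M_pos by auto
  \<comment> \<open>Trading the minimal weight \<open>\<alpha> i\<close> on all of \<open>K\<close> for weight on \<open>p 0\<close> removes \<open>v i\<close>.\<close>
  then obtain i where i: "i \<in> K" "\<And>k. k \<in> K \<Longrightarrow> \<alpha> i \<le> \<alpha> k"
    using finite_K by (metis arg_min_if_finite(1) arg_min_least)
  then have "i < d" using K_subset by auto
  define \<beta> where "\<beta> k = \<alpha> k - (if k \<in> K then \<alpha> i else 0)" for k
  have \<beta>: "0 \<le> \<beta> k" if "k < d" for k
    using i \<alpha>0[OF that] by (auto simp: \<beta>_def)
  have "\<beta> i = 0" using i by (simp add: \<beta>_def)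
  have K_sum: "(\<Sum>k<d. if k \<in> K then f k else 0) = sum f K" for f :: "nat \<Rightarrow> 'b::comm_monoid_add"
    using K_subset by (simp add: sum.If_cases Int_absorb1)
  \<comment> \<open>Total weight on the spine: the traded weight, now on \<open>p 0\<close>, plus
    that of \<open>p N\<close>. Only \<open>p N\<close> lies above the base, so the height
    contributed is \<open>real N * \<gamma>\<close>.\<close>
  define t where "t = of_int M * \<alpha> i + \<gamma>"
  have "t \<ge> 0"
    using M_pos \<alpha>0[OF \<open>i < d\<close>] \<gamma>0 by (simp add: t_def)
  have "\<gamma> \<le> t"
    using M_pos \<alpha>0[OF \<open>i < d\<close>] by (simp add: t_def)
  then have "real N * \<gamma> \<le> real N * t"
    by (intro mult_left_mono) auto
  then obtain j z where j: "j < N" "z \<in> closed_segment (real_vec (p j)) (real_vec (p (Suc j)))"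
    "t *\<^sub>R z = t *\<^sub>R real_vec (p 0) + (real N * \<gamma>) *\<^sub>R axis (e d) 1"
    using segment_cell[of t "real N * \<gamma>"] \<open>t \<ge> 0\<close> \<gamma>0 by auto
  have K_part: "(\<Sum>k<d. (if k \<in> K then \<alpha> i else 0) *\<^sub>R real_vec (v k))
      = (of_int M * \<alpha> i) *\<^sub>R real_vec (p 0)"
  proof -
    have "(\<Sum>k<d. (if k \<in> K then \<alpha> i else 0) *\<^sub>R real_vec (v k))
        = (\<Sum>k\<in>K. \<alpha> i *\<^sub>R real_vec (v k))"
      unfolding K_sum[symmetric] by (intro sum.cong) auto
    also have "\<dots> = \<alpha> i *\<^sub>R (of_int M *\<^sub>R real_vec (p 0))"
      by (simp only: sum_v_real flip: scaleR_sum_right)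
    finally show ?thesis by (simp add: mult.commute)
  qed
  have "x = (\<Sum>k<d. \<beta> k *\<^sub>R real_vec (v k)) + t *\<^sub>R z"
  proof -
    have "(\<Sum>k<d. \<beta> k *\<^sub>R real_vec (v k))
        = (\<Sum>k<d. \<alpha> k *\<^sub>R real_vec (v k)) - (of_int M * \<alpha> i) *\<^sub>R real_vec (p 0)"
      unfolding K_part[symmetric] \<beta>_def by (simp only: scaleR_diff_left sum_subtractf)
    moreover have "t *\<^sub>R z = (of_int M * \<alpha> i) *\<^sub>R real_vec (p 0) + \<gamma> *\<^sub>R real_vec (p N)"
      unfolding j(3) by (simp add: p_add_real[of N] t_def algebra_simps)
    ultimately show ?thesis
      by (simp add: x)
  qed
  \<comment> \<open>Since \<open>\<beta> i\<close> is zero, slot i is free for the spine point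
    \<open>z\<close> with weight \<open>t\<close>.\<close>
  also have "\<dots> = (\<Sum>k<d. (if k = i then t else \<beta> k) *\<^sub>R (if k = i then z else real_vec (v k)))"
    using \<open>i < d\<close> \<open>\<beta> i = 0\<close>
    by (simp add: sum.remove[of "{..<d}" i] add.commute)
  also have "\<dots> \<in> convex hull W (i, j)"
  proof (rule convex_sum)
    show "(\<Sum>k<d. if k = i then t else \<beta> k) = 1"
    proof -
      have "(\<Sum>k<d. if k = i then t else \<beta> k) = t + (\<Sum>k<d. \<beta> k)"
        using \<open>i < d\<close> \<open>\<beta> i = 0\<close> by (simp add: sum.remove[of "{..<d}" i])
      also have "(\<Sum>k<d. \<beta> k) = (\<Sum>k<d. \<alpha> k) - (\<Sum>k\<in>K. \<alpha> i)"
        unfolding \<beta>_def by (simp add: sum_subtractf K_sum)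
      also have "(\<Sum>k\<in>K. \<alpha> i) = of_int M * \<alpha> i"
        by (simp add: real_card_K)
      finally show ?thesis
        using sum1 by (simp add: t_def)
    qed
    show "0 \<le> (if k = i then t else \<beta> k)" if "k \<in> {..<d}" for k
      using that \<beta> \<open>t \<ge> 0\<close> by auto
    have "closed_segment (real_vec (p j)) (real_vec (p (Suc j))) \<subseteq> convex hull W (i, j)"
      unfolding segment_convex_hull by (intro hull_mono) (auto simp: W_def cell_points_def)
    then have "z \<in> convex hull W (i, j)"
      using j(2) by blast
    moreover have "real_vec (v k) \<in> convex hull W (i, j)" if "k < d" "k \<noteq> i" for k
      using that by (intro hull_inc) (auto simp: in_W_iff cell_points_def)
    ultimately show "(if k = i then z else real_vec (v k)) \<in> convex hull W (i, j)" if "k \<in> {..<d}" for k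
      using that by simp
  qed auto
  finally show "x \<in> (\<Union>c\<in>C. convex hull W c)"
    using i(1) j(1) by (auto simp: C_def)
qed

lemma Union_cells: "(\<Union>c\<in>C. convex hull W c) = S"
  and hull_cells: "convex hull (\<Union>c\<in>C. W c) = S"
proof -
  have "convex hull (\<Union>c\<in>C. W c) \<subseteq> S"
    using W_subset_S by (intro hull_minimal) (auto simp: S_def)
  moreover have "(\<Union>c\<in>C. convex hull W c) \<subseteq> convex hull (\<Union>c\<in>C. W c)"
    by (intro UN_least hull_mono) auto
  ultimately show "(\<Union>c\<in>C. convex hull W c) = S" "convex hull (\<Union>c\<in>C. W c) = S"
    using S_subset_cells by auto
qed

sublocale supported_cells C W \<omega> g h
proof
  show "finite C" by (simp add: C_def finite_K)
  show "(\<Union>c\<in>C. convex hull W c) = convex hull (\<Union>c\<in>C. W c)"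
    by (simp add: Union_cells hull_cells)
qed (use cell_indep cell_card support in auto)

section \<open>Lattice, unimodular and flag properties\<close>

lemma lattice_triangulation_cells: "lattice_triangulation S cells"
  unfolding lattice_triangulation_def
proof (intro conjI ballI)
  show "\<Union> cells = S"
    using Union_cells by (simp add: cells_def)
  show "vertices T \<subseteq> range real_vec" if T: "T \<in> cells" for T
  proof -
    obtain c where "c \<in> C" "T = convex hull W c" using T by (auto simp: cells_def)
    then have "vertices T = W c" by (simp add: vertices_cell)
    then show ?thesis by (auto simp: W_def)
  qed
qed (use triangulation_cells simplex_cells in auto)

lemma unimodular_cells: "unimodular_triangulation cells"
  by (auto simp: unimodular_triangulation_def cells_def cell_volume)

lemma is_face_cells: "is_face cells \<sigma> \<longleftrightarrow> (\<exists>c\<in>C. \<sigma> \<subseteq> W c)"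
  by (auto simp: is_face_def cells_def vertices_cell)

text \<open>In a minimal nonface of size other than 2, any two points share a cell. Here
  \<open>K\<close> is {1, 2} and every cell omits \<open>v 1\<close> or \<open>v 2\<close>, so one
  of them is absent; the indices of its spine points differ by at most 1. Then all its points fit
  into one cell, a contradiction.\<close>

lemma flag_cells:
  assumes d: "d = 3" "M = 2"
  shows "flag_triangulation cells"
  unfolding flag_triangulation_def
proof (intro allI impI, rule ccontr)
  fix \<sigma> assume \<sigma>: "minimal_nonface cells \<sigma>" "card \<sigma> \<noteq> 2"
  note nonface = \<sigma>(1)[unfolded minimal_nonface_def]
  have K: "K = {1, 2}"
    unfolding K_def using d by auto
  \<comment> \<open>Facet form k is 2 at \<open>v k\<close> but 1 on the spine.\<close>
  have not_p: "v k \<notin> range p" if "k \<in> K" for k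
    using facet_form_p[OF that] facet_form_v[of k k] that K_subset d by (auto simp: image_iff)
  have pair: "\<exists>c\<in>C. {x, y} \<subseteq> W c" if "x \<in> \<sigma>" "y \<in> \<sigma>" "x \<noteq> y" for x y
  proof -
    have "{x, y} \<noteq> \<sigma>" using \<sigma>(2) that(3) by auto
    then have "{x, y} \<subset> \<sigma>" using that by auto
    then have "is_face cells {x, y}"
      by (rule nonface[THEN conjunct2, THEN conjunct2, THEN spec, THEN mp])
    then show ?thesis by (simp only: is_face_cells)
  qed
  have \<sigma>_subset: "\<sigma> \<subseteq> (\<Union>c\<in>C. W c)"
    using nonface[THEN conjunct1] by (simp only: Vert_cells)
  have points: "(\<exists>l\<le>N. x = real_vec (p l)) \<or> (\<exists>k<d. x = real_vec (v k))" if "x \<in> \<sigma>" for x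
  proof -
    have "x \<in> (\<Union>c\<in>C. W c)"
      using \<sigma>_subset that by (rule subsetD)
    then obtain i j where "j < N" "x \<in> W (i, j)"
      by (auto simp: C_def)
    moreover from this obtain y where "x = real_vec y" "y \<in> cell_points (i, j)"
      by (auto simp: W_def)
    moreover from this consider "y = p j" | "y = p (Suc j)" | k where "k < d" "y = v k"
      unfolding cell_points_def by auto
    ultimately show ?thesis
      by (metis Suc_leI less_imp_le_nat)
  qed
  have "\<exists>i\<in>K. real_vec (v i) \<notin> \<sigma>"
  proof (rule ccontr)
    assume "\<not> ?thesis"
    then have "real_vec (v 1) \<in> \<sigma>" "real_vec (v 2) \<in> \<sigma>" using K by auto
    moreover have "v 1 \<noteq> v 2"
      using inj_onD[OF inj_v, of 1 2] d by auto
    ultimately obtain i j where ij: "(i, j) \<in> C" "v 1 \<in> cell_points (i, j)" "v 2 \<in> cell_points (i, j)"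
      using pair[of "real_vec (v 1)" "real_vec (v 2)"] by (auto simp: in_W_iff inj_eq[OF inj_real_vec])
    have i: "i \<in> K"
      using ij(1) by (simp add: C_def)
    then have "i = 1 \<or> i = 2"
      unfolding K by simp
    then have "v i \<in> cell_points (i, j)"
      using ij(2,3) by blast
    moreover have "i < d"
      using i K_subset by blast
    ultimately show False
      using v_in_cell[OF i _ not_p[OF i]] by blast
  qed
  then obtain i where i: "i \<in> K" "real_vec (v i) \<notin> \<sigma>" by blast
  define I where "I = {l. l \<le> N \<and> real_vec (p l) \<in> \<sigma>}"
  have near: "l' \<le> Suc l" if "l \<in> I" "l' \<in> I" for l l'
  proof (cases "l = l'")
    case False
    then have "\<exists>c\<in>C. {real_vec (p l), real_vec (p l')} \<subseteq> W c"
      using that by (intro pair) (auto simp: I_def inj_eq[OF inj_real_vec] inj_p)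
    then obtain i j where i: "i \<in> K" and "p l \<in> cell_points (i, j)" "p l' \<in> cell_points (i, j)"
      by (auto simp: C_def in_W_iff)
    then show ?thesis
      using p_in_cell[OF i] by auto
  qed simp
  have "\<exists>j<N. I \<subseteq> {j, Suc j}"
  proof (cases "I = {}")
    case True
    then show ?thesis using N by auto
  next
    case False
    have fin: "finite I" by (simp add: I_def)
    define m where "m = Min I"
    have m: "m \<in> I" "\<And>l. l \<in> I \<Longrightarrow> m \<le> l"
      using False fin by (auto simp: m_def)
    \<comment> \<open>The cap handles m = N, where only the segment ending at \<open>p N\<close> is
      available.\<close>
    have "I \<subseteq> {min m (N - 1), Suc (min m (N - 1))}"
    proof
      fix l assume l: "l \<in> I"
      then have "m \<le> l" "l \<le> Suc m" "l \<le> N"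
        using m near by (auto simp: I_def)
      then show "l \<in> {min m (N - 1), Suc (min m (N - 1))}"
        using N by (auto simp: min_def)
    qed
    then show ?thesis using N by (intro exI[of _ "min m (N - 1)"]) auto
  qed
  then obtain j where j: "j < N" "I \<subseteq> {j, Suc j}" by blast
  have "\<sigma> \<subseteq> W (i, j)"
  proof
    fix x assume x: "x \<in> \<sigma>"
    from points[OF this] show "x \<in> W (i, j)"
    proof (elim disjE exE conjE)
      fix l assume "l \<le> N" "x = real_vec (p l)"
      then show ?thesis
        using x j(2) p_in_cell[OF i(1)] by (auto simp: I_def in_W_iff)
    next
      fix k assume "k < d" "x = real_vec (v k)"
      moreover from this have "k \<noteq> i" using x i(2) by auto
      ultimately show ?thesis
        by (auto simp: in_W_iff cell_points_def)
    qed
  qed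
  moreover have "(i, j) \<in> C"
    using i(1) j(1) by (simp add: C_def)
  ultimately have "is_face cells \<sigma>"
    unfolding is_face_cells by blast
  with nonface[THEN conjunct2, THEN conjunct1] show False
    by contradiction
qed

end

section \<open>Specialisation to the given vectors\<close>

theorem theorem3:
  fixes d :: nat and M N :: int
    and e :: "nat \<Rightarrow> 'n::finite"
    and a b :: "int ^ 'n"
  assumes "d = CARD('n)" and "bij_betw e {1..d} UNIV"
    and "d \<ge> 2" and "N > 1"
    and "\<forall>i\<in>{1..d - 1}. a $ e i = 1" and "a $ e d = N"
    and "\<forall>i\<in>{1..d - 2}. b $ e i = M - 1" and "b $ e (d - 1) = M" and "b $ e d = 0"
    and "M = int d - 1 \<or> M = int d"
  shows "\<exists>\<T>. lattice_triangulation (hnf_simplex e a b) \<T> \<and>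
             regular_triangulation \<T> \<and> unimodular_triangulation \<T> \<and>
             (d = 3 \<and> M = int d - 1 \<longrightarrow> flag_triangulation \<T>)"
proof -
  interpret H: hnf d e M "nat N"
    by unfold_locales (use assms in simp_all)
  have a: "a = H.p (nat N)"
    unfolding H.vec_eq_e
  proof
    fix k assume k: "k \<in> {1..d}"
    then consider "k = d" | "k \<in> {1..d - 1}" "k \<noteq> d"
      by force
    then show "a $ e k = H.p (nat N) $ e k"
      using k assms(4-6) by cases (simp_all add: H.p_nth)
  qed
  have b: "b = H.v (d - 1)"
    unfolding H.vec_eq_e
  proof
    fix k assume k: "k \<in> {1..d}"
    then consider "k = d" | "k = d - 1" "k < d" | "k \<in> {1..d - 2}" "k < d - 1"
      by force
    then show "b $ e k = H.v (d - 1) $ e k"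
    proof cases
      case 1
      then show ?thesis
        using H.v_nth[OF k, of "d - 1"] assms(3,9) by simp
    next
      case 2
      then show ?thesis
        using H.v_nth[OF k, of "d - 1"] assms(3,8) by simp
    next
      case 3
      then have "b $ e k = M - 1" using assms(7) by blast
      then show ?thesis
        using H.v_nth[OF k, of "d - 1"] assms(3) 3(2) by simp
    qed
  qed
  have "{0} \<union> (\<lambda>i. axis (e i) 1) ` {1..CARD('n) - 2} \<union> {real_vec b, real_vec a}
      = real_vec ` insert (H.p (nat N)) (H.v ` {..<d})"
  proof -
    \<comment> \<open>Index 0 is the origin, d - 1 is \<open>b\<close>, and the indices between are
      the unit vectors.\<close>
    have d: "{..<d} = insert 0 (insert (d - 1) {1..d - 2})"
      using assms(3) by auto
    have "(\<lambda>i. axis (e i) 1) ` {1..d - 2} = (\<lambda>i. real_vec (H.v i)) ` {1..d - 2}"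
    proof (rule image_cong)
      fix i assume "i \<in> {1..d - 2}"
      then have "H.v i = axis (e i) 1" by (auto simp: H.v_def)
      then show "axis (e i) 1 = real_vec (H.v i)" by (simp add: vec_eq_iff axis_def)
    qed simp
    then show ?thesis
      unfolding d a b H.dim by (auto simp: image_image H.v_0 real_vec_0)
  qed
  then have S: "hnf_simplex e a b = H.S"
    unfolding hnf_simplex_def H.S_def by (rule arg_cong)
  show ?thesis
    unfolding S using H.lattice_triangulation_cells H.regular_cells H.unimodular_cells
      H.flag_cells assms(1) by auto
qed

end
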